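(* Consider the network model with finite buffers, and suppose that the graph $\mathcal{G}_0=(\mathbf{N},\mathbf{A}_0)$ associated with the matrix $G_0$ is acyclic. Let $p$ be the length of the longest path in $\mathcal{G}_0$. (i) (Manufacturing blocking.) The implicit equation $$ d(k)=\mathcal{T}_k\otimes G_0^{T}\otimes d(k)\;\oplus\;\mathcal{T}_k\otimes d(k-1)\;\oplus\;\bigoplus_{m=1}^{M}(\mathcal{T}_k\otimes G_m^{T}\oplus H_m)\otimes d(k-m) $$ can be solved to produce the explicit state dynamic equation $d(k)=\bigoplus_{m=1}^{M}T_m(k)\otimes d(k-m)$ with the state transition matrices $$ T_1(k)=(E\oplus\mathcal{T}_k\otimes G_0^{T})^{p}\otimes(\mathcal{T}_k\oplus\mathcal{T}_k\otimes G_1^{T}\oplus H_1), $$ $$ T_m(k)=(E\oplus\mathcal{T}_k\otimes G_0^{T})^{p}\otimes(\mathcal{T}_k\otimes G_m^{T}\oplus H_m),\qquad m=2,\ldots,M. $$ (ii) (Communication blocking.) The implicit equation $$ d(k)=\mathcal{T}_k\otimes G_0^{T}\otimes d(k)\;\oplus\;\mathcal{T}_k\otimes d(k-1)\;\oplus\;\mathcal{T}_k\otimes\bigoplus_{m=1}^{M}(G_m^{T}\oplus H_m)\otimes d(k-m) $$ can be solved to produce the explicit state dynamic equation $d(k)=\bigoplus_{m=1}^{M}T_m(k)\otimes d(k-m)$ with the state transition matrices $$ T_1(k)=(E\oplus\mathcal{T}_k\otimes G_0^{T})^{p}\otimes\mathcal{T}_k\otimes(E\oplus G_1^{T}\oplus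 H_1), $$ $$ T_m(k)=(E\oplus\mathcal{T}_k\otimes G_0^{T})^{p}\otimes\mathcal{T}_k\otimes(G_m^{T}\oplus H_m),\qquad m=2,\ldots,M. $$
   Context: Max-plus algebra: $\underline{\mathbb{R}}=\mathbb{R}\cup\{\varepsilon\}$ with $\varepsilon=-\infty$, $x\oplus y=\max(x,y)$, $x\otimes y=x+y$ (with $x\otimes\varepsilon=\varepsilon\otimes x=\varepsilon$), and identity element $e=0$. For matrices and vectors over $\underline{\mathbb{R}}$, $\oplus$ is entrywise and $(X\otimes Y)_{ij}=\bigoplus_k x_{ik}\otimes y_{kj}$, where $\bigoplus$ is iterated $\oplus$. The null matrix $\mathcal{E}$ has all entries $\varepsilon$; the identity matrix $E$ has diagonal entries $e$ and off-diagonal entries $\varepsilon$. Powers: $X^0=E$, $X^q=X\otimes\cdots\otimes X$ ($q$ factors). $X^T$ is the transpose. The graph associated with an $n\times n$ matrix $X$ is the oriented graph on $\{1,\ldots,n\}$ having arc $(i,j)$ if and only if $x_{ij}\ne\varepsilon$; it is acyclic if it has no oriented circuit. Network model: the network has $n$ single-server first-come-first-served fork-join nodes and topology given by an oriented graph $\mathcal{G}=(\mathbf{N},\mathbf{A})$, $\mathbf{N}=\{1,\ldots,n\}$, $\mathbf{A}\subset\mathbf{N}\times\mathbf{N}$ (not necessarily acyclic), where $(i,j)\in\mathbf{A}$ iff node $i$ passes customers directly to node $j$. Put $\mathbf{P}(i)=\{j:(j,i)\in\mathbf{A}\}$ and $\mathbf{S}(i)=\{j:(i,j)\in\mathbf{A}\}$.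 Node $i$ has a buffer of capacity $s_i$ and initially $r_i$ customers in it, $0\le r_i\le s_i\le\infty$, with its server initially free; $r_i=s_i=\infty$ whenever $\mathbf{P}(i)=\emptyset$ (such a node represents an infinite external arrival stream). The service time of the $k$th customer at node $i$ is a given $\tau_{ik}>0$, $k=1,2,\ldots$. The variables $a_i(k),b_i(k),c_i(k),d_i(k)$ are the $k$th arrival, service initiation, service completion and departure epochs at node $i$; $d_i(0)=e$ and $d_i(k)=\varepsilon$ for $k<0$. The dynamics are: $a_i(k)=\bigoplus_{j\in\mathbf{P}(i)}d_j(k-r_i)$ if $\mathbf{P}(i)\ne\emptyset$ and $a_i(k)=\varepsilon$ otherwise; $c_i(k)=\tau_{ik}\otimes b_i(k)$; and, with $\mathcal{D}_i(k)=\bigoplus_{j\in\mathbf{S}(i)}d_j(k-s_j-1)$ if $\mathbf{S}(i)\neq\emptyset$ and $\mathcal{D}_i(k)=\varepsilon$ otherwise, the following. Under manufacturing blocking (a customer that completed service at $i$ cannot release the server while some successor's buffer is full): $b_i(k)=a_i(k)\oplus d_i(k-1)$ and $d_i(k)=c_i(k)\oplus\mathcal{D}_i(k)$. Under communication blocking (server $i$ does not start service until every successor's buffer has an empty space): $b_i(k)=a_i(k)\oplus d_i(k-1)\oplus\mathcal{D}_i(k)$ and $d_i(k)=c_i(k)$. The implicit equations in (i) and (ii) are the vector forms of these two systems, respectively. Notation: $d(k)=(d_1(k),\ldots,d_n(k))^T$. $\mathcal{T}_k$ is the $n\times n$ matrix with diagonal entries $\tau_{1k},\ldots,\tau_{nk}$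 and off-diagonal entries $\varepsilon$. $M_r=\max\{r_i:r_i<\infty,\ i=1,\ldots,n\}$ and $M_s=\max\{s_i+1:s_i<\infty,\ i=1,\ldots,n\}$. It is assumed that $M_r\le M_s$, and $M=M_s$. For $m=0,1,\ldots,M_r$, $G_m=(g^m_{ij})$ with $g^m_{ij}=e$ if $i\in\mathbf{P}(j)$ and $m=r_j$, and $g^m_{ij}=\varepsilon$ otherwise; if $M_r<M_s$, then $G_m=\mathcal{E}$ for $m=M_r+1,\ldots,M_s$ (so that one may regard $M_r=M_s=M$). For $m=1,\ldots,M$, $H_m=(h^m_{ij})$ with $h^m_{ij}=e$ if $j\in\mathbf{S}(i)$ and $m=s_j+1$, and $h^m_{ij}=\varepsilon$ otherwise. The graph associated with $G_0$ is $\mathcal{G}_0=(\mathbf{N},\mathbf{A}_0)$, $\mathbf{A}_0=\{(i,j): i\in\mathbf{P}(j),\ r_j=0\}$. *)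

theory Defs
  imports "HOL-Analysis.Analysis" "HOL-Library.Extended_Nat"
begin

text \<open>
  Max-plus algebra as a commutative semiring: \<open>+\<close> is the maximum, \<open>*\<close> is real addition,
  \<open>0\<close> is \<open>\<epsilon> = -\<infinity>\<close> and \<open>1\<close> is \<open>e\<close>, the real number zero.  Hence for matrices and vectors
  over \<open>maxplus\<close> the library operations \<open>+\<close>, \<open>**\<close>, \<open>*v\<close>, \<open>\<Sum>\<close>, \<open>mat 1\<close> and \<open>0\<close> are the
  max-plus sum, the two products, the iterated sum, the identity \<open>E\<close> and the null matrix.
  In particular a sum over an empty set is \<open>\<epsilon>\<close>.
\<close>

datatype maxplus = Eps | Fin real

instantiation maxplus :: comm_semiring_1
begin

definition zero_maxplus :: maxplus where "0 = Eps"

definition one_maxplus :: maxplus where "1 = Fin 0"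

fun plus_maxplus :: "maxplus \<Rightarrow> maxplus \<Rightarrow> maxplus" where
  "Eps + y = y"
| "Fin x + Eps = Fin x"
| "Fin x + Fin y = Fin (max x y)"

fun times_maxplus :: "maxplus \<Rightarrow> maxplus \<Rightarrow> maxplus" where
  "Eps * y = Eps"
| "Fin x * Eps = Eps"
| "Fin x * Fin y = Fin (x + y)"

instance
proof
  fix a b c :: maxplus
  show "a + b + c = a + (b + c)"
    by (cases a; cases b; cases c) (auto simp: max.assoc)
  show "a + b = b + a"
    by (cases a; cases b) (auto simp: max.commute)
  show "0 + a = a"
    by (simp add: zero_maxplus_def)
  show "a * b * c = a * (b * c)"
    by (cases a; cases b; cases c) auto
  show "a * b = b * a"
    by (cases a; cases b) auto
  show "1 * a = a"
    by (cases a) (auto simp: one_maxplus_def)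
  show "(a + b) * c = a * c + b * c"
    by (cases a; cases b; cases c) (auto simp: max_def)
  show "0 * a = 0" "a * 0 = 0"
    by (cases a; simp add: zero_maxplus_def)+
  show "(0::maxplus) \<noteq> 1"
    by (simp add: zero_maxplus_def one_maxplus_def)
qed

end

text \<open>The library's \<open>^\<close> on \<open>'a^'n^'n\<close> is entrywise, hence a separate matrix power.\<close>

primrec matpow :: "maxplus^'n^'n \<Rightarrow> nat \<Rightarrow> maxplus^'n^'n" where
  "matpow X 0 = mat 1"
| "matpow X (Suc q) = X ** matpow X q"

definition graph_of :: "maxplus^'n^'n \<Rightarrow> ('n \<times> 'n) set" where
  "graph_of X = {(i, j). X $ i $ j \<noteq> 0}"

text \<open>A path is the list of the vertices it visits; its length is the number of its arcs.\<close>

definition is_path :: "('a \<times> 'a) set \<Rightarrow> 'a list \<Rightarrow> bool" where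
  "is_path R xs \<longleftrightarrow> xs \<noteq> [] \<and> distinct xs \<and> successively (\<lambda>x y. (x, y) \<in> R) xs"

definition longest_path_length :: "('a \<times> 'a) set \<Rightarrow> nat" where
  "longest_path_length R = Max {length xs - 1 | xs. is_path R xs}"

definition preds :: "('n \<times> 'n) set \<Rightarrow> 'n \<Rightarrow> 'n set" where
  "preds A i = {j. (j, i) \<in> A}"

definition succs :: "('n \<times> 'n) set \<Rightarrow> 'n \<Rightarrow> 'n set" where
  "succs A i = {j. (i, j) \<in> A}"

text \<open>
  A network is given by its arcs \<open>A\<close>, the initial numbers of customers \<open>r\<close>, the buffer
  capacities \<open>s\<close> and the service times \<open>\<tau> i k\<close>, used only for \<open>k \<ge> 1\<close>.
\<close>

definition fork_join_network ::
  "('n \<times> 'n) set \<Rightarrow> ('n \<Rightarrow> enat) \<Rightarrow> ('n \<Rightarrow> enat) \<Rightarrow> ('n \<Rightarrow> int \<Rightarrow> real) \<Rightarrow> bool" where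
  "fork_join_network A r s \<tau> \<longleftrightarrow>
     (\<forall>i. r i \<le> s i) \<and>
     (\<forall>i. preds A i = {} \<longrightarrow> r i = \<infinity> \<and> s i = \<infinity>) \<and>
     (\<forall>i. \<forall>k\<ge>1. \<tau> i k > 0)"

definition initial_departures :: "(int \<Rightarrow> maxplus^'n) \<Rightarrow> bool" where
  "initial_departures d \<longleftrightarrow> (\<forall>i. d 0 $ i = 1) \<and> (\<forall>k<0. \<forall>i. d k $ i = 0)"

text \<open>\<open>d (k - l)\<close>, where an infinite lag gives \<open>\<epsilon>\<close> because departures vanish at negative indices.\<close>

definition delayed :: "(int \<Rightarrow> maxplus^'n) \<Rightarrow> int \<Rightarrow> enat \<Rightarrow> maxplus^'n" where
  "delayed d k l = (case l of enat m \<Rightarrow> d (k - int m) | \<infinity> \<Rightarrow> 0)"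

definition arrival :: "('n \<times> 'n) set \<Rightarrow> ('n \<Rightarrow> enat) \<Rightarrow> (int \<Rightarrow> maxplus^'n::finite) \<Rightarrow> int \<Rightarrow> 'n \<Rightarrow> maxplus" where
  "arrival A r d k i = (\<Sum>j\<in>preds A i. delayed d k (r i) $ j)"

definition blocking :: "('n \<times> 'n) set \<Rightarrow> ('n \<Rightarrow> enat) \<Rightarrow> (int \<Rightarrow> maxplus^'n::finite) \<Rightarrow> int \<Rightarrow> 'n \<Rightarrow> maxplus" where
  "blocking A s d k i = (\<Sum>j\<in>succs A i. delayed d k (s j + 1) $ j)"

definition manufacturing_dynamics ::
  "('n::finite \<times> 'n) set \<Rightarrow> ('n \<Rightarrow> enat) \<Rightarrow> ('n \<Rightarrow> enat) \<Rightarrow> ('n \<Rightarrow> int \<Rightarrow> real) \<Rightarrow>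
   (int \<Rightarrow> maxplus^'n) \<Rightarrow> (int \<Rightarrow> maxplus^'n) \<Rightarrow> (int \<Rightarrow> maxplus^'n) \<Rightarrow> (int \<Rightarrow> maxplus^'n) \<Rightarrow> bool" where
  "manufacturing_dynamics A r s \<tau> a b c d \<longleftrightarrow>
     (\<forall>k\<ge>1. \<forall>i.
        a k $ i = arrival A r d k i \<and>
        b k $ i = a k $ i + d (k - 1) $ i \<and>
        c k $ i = Fin (\<tau> i k) * b k $ i \<and>
        d k $ i = c k $ i + blocking A s d k i)"

definition communication_dynamics ::
  "('n::finite \<times> 'n) set \<Rightarrow> ('n \<Rightarrow> enat) \<Rightarrow> ('n \<Rightarrow> enat) \<Rightarrow> ('n \<Rightarrow> int \<Rightarrow> real) \<Rightarrow>
   (int \<Rightarrow> maxplus^'n) \<Rightarrow> (int \<Rightarrow> maxplus^'n) \<Rightarrow> (int \<Rightarrow> maxplus^'n) \<Rightarrow> (int \<Rightarrow> maxplus^'n) \<Rightarrow> bool" where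
  "communication_dynamics A r s \<tau> a b c d \<longleftrightarrow>
     (\<forall>k\<ge>1. \<forall>i.
        a k $ i = arrival A r d k i \<and>
        b k $ i = a k $ i + d (k - 1) $ i + blocking A s d k i \<and>
        c k $ i = Fin (\<tau> i k) * b k $ i \<and>
        d k $ i = c k $ i)"

definition M_r :: "('n \<Rightarrow> enat) \<Rightarrow> nat" where
  "M_r r = Max {m. \<exists>i. r i = enat m}"

definition M_s :: "('n \<Rightarrow> enat) \<Rightarrow> nat" where
  "M_s s = Max {m + 1 | m. \<exists>i. s i = enat m}"

definition T_service :: "('n \<Rightarrow> int \<Rightarrow> real) \<Rightarrow> int \<Rightarrow> maxplus^'n^'n" where
  "T_service \<tau> k = (\<chi> i j. if i = j then Fin (\<tau> i k) else 0)"

definition G_mat :: "('n \<times> 'n) set \<Rightarrow> ('n \<Rightarrow> enat) \<Rightarrow> nat \<Rightarrow> maxplus^'n^'n" where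
  "G_mat A r m =
     (if m \<le> M_r r then \<chi> i j. if i \<in> preds A j \<and> r j = enat m then 1 else 0 else 0)"

definition H_mat :: "('n \<times> 'n) set \<Rightarrow> ('n \<Rightarrow> enat) \<Rightarrow> nat \<Rightarrow> maxplus^'n^'n" where
  "H_mat A s m = (\<chi> i j. if j \<in> succs A i \<and> enat m = s j + 1 then 1 else 0)"

definition manufacturing_transition ::
  "('n::finite \<times> 'n) set \<Rightarrow> ('n \<Rightarrow> enat) \<Rightarrow> ('n \<Rightarrow> enat) \<Rightarrow> ('n \<Rightarrow> int \<Rightarrow> real) \<Rightarrow>
   nat \<Rightarrow> nat \<Rightarrow> int \<Rightarrow> maxplus^'n^'n" where
  "manufacturing_transition A r s \<tau> p m k =
     matpow (mat 1 + T_service \<tau> k ** transpose (G_mat A r 0)) p **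
     (if m = 1
      then T_service \<tau> k + T_service \<tau> k ** transpose (G_mat A r 1) + H_mat A s 1
      else T_service \<tau> k ** transpose (G_mat A r m) + H_mat A s m)"

definition communication_transition ::
  "('n::finite \<times> 'n) set \<Rightarrow> ('n \<Rightarrow> enat) \<Rightarrow> ('n \<Rightarrow> enat) \<Rightarrow> ('n \<Rightarrow> int \<Rightarrow> real) \<Rightarrow>
   nat \<Rightarrow> nat \<Rightarrow> int \<Rightarrow> maxplus^'n^'n" where
  "communication_transition A r s \<tau> p m k =
     matpow (mat 1 + T_service \<tau> k ** transpose (G_mat A r 0)) p ** T_service \<tau> k **
     (if m = 1
      then mat 1 + transpose (G_mat A r 1) + H_mat A s 1
      else transpose (G_mat A r m) + H_mat A s m)"

definition manufacturing_equation ::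
  "('n::finite \<times> 'n) set \<Rightarrow> ('n \<Rightarrow> enat) \<Rightarrow> ('n \<Rightarrow> enat) \<Rightarrow> ('n \<Rightarrow> int \<Rightarrow> real) \<Rightarrow>
   nat \<Rightarrow> (int \<Rightarrow> maxplus^'n) \<Rightarrow> int \<Rightarrow> bool" where
  "manufacturing_equation A r s \<tau> M d k \<longleftrightarrow>
     d k = T_service \<tau> k ** transpose (G_mat A r 0) *v d k
         + T_service \<tau> k *v d (k - 1)
         + (\<Sum>m = 1..M. (T_service \<tau> k ** transpose (G_mat A r m) + H_mat A s m) *v d (k - int m))"

definition communication_equation ::
  "('n::finite \<times> 'n) set \<Rightarrow> ('n \<Rightarrow> enat) \<Rightarrow> ('n \<Rightarrow> enat) \<Rightarrow> ('n \<Rightarrow> int \<Rightarrow> real) \<Rightarrow>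
   nat \<Rightarrow> (int \<Rightarrow> maxplus^'n) \<Rightarrow> int \<Rightarrow> bool" where
  "communication_equation A r s \<tau> M d k \<longleftrightarrow>
     d k = T_service \<tau> k ** transpose (G_mat A r 0) *v d k
         + T_service \<tau> k *v d (k - 1)
         + T_service \<tau> k *v (\<Sum>m = 1..M. (transpose (G_mat A r m) + H_mat A s m) *v d (k - int m))"

end

theory Submission imports Defs begin

text \<open>
  Over an idempotent semiring the implicit equation \<open>x = N x \<oplus> v\<close> is solved by iterating it: after
  \<open>q\<close> substitutions \<open>x = N\<^bsup>q+1\<^esup> x \<oplus> (v \<oplus> N v \<oplus> \<dots> \<oplus> N\<^sup>q v)\<close>, and idempotence turns the partial
  Neumann series in brackets into \<open>(E \<oplus> N)\<^sup>q v\<close>, since binomial coefficients disappear.  As soon as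
  \<open>N\<^bsup>p+1\<^esup> = \<E>\<close>, the term in \<open>x\<close> drops out, so \<open>(E \<oplus> N)\<^sup>p v\<close> is the only candidate, and it is
  indeed a solution because the series has become stationary (\<open>implicit_iff_explicit\<close>).

  Here \<open>N = \<T>\<^sub>k \<otimes> G\<^sub>0\<^sup>T\<close>.  Multiplication by the diagonal matrix \<open>\<T>\<^sub>k\<close> creates no arcs and the
  transpose reverses them, so a finite entry of \<open>N\<^sup>q\<close> is witnessed by a walk with \<open>q\<close> arcs in the graph of
  \<open>G\<^sub>0\<close>.  In an acyclic graph a walk visits no vertex twice, hence \<open>q\<close> is at most the length of a
  longest path (\<open>matpow_eq_0_of_acyclic\<close>).

  The implicit equations are the vector forms of the recursions: the matrices \<open>G\<^sub>m\<close> sort the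
  predecessors, and \<open>H\<^sub>m\<close> the successors, by the lag with which their departures enter, and \<open>M\<close> bounds all
  finite lags (\<open>arrival_eq_sum\<close>, \<open>blocking_eq_sum\<close>).  Nodes with an infinite lag contribute \<open>\<epsilon>\<close> to both
  sides.
\<close>

section \<open>Linear equations over an idempotent semiring\<close>

lemma maxplus_add_idem: "(x::maxplus) + x = x"
  by (cases x) auto

lemma vec_add_idem: "(x::maxplus^'n) + x = x"
  by (simp add: vec_eq_iff maxplus_add_idem)

lemma vec_add_absorb: "(x::maxplus^'n) + (x + y) = x + y"
  by (simp add: vec_add_idem flip: add.assoc)

lemma matpow_Suc_vec: "matpow X (Suc q) *v v = X *v (matpow X q *v v)"
  by (simp add: matrix_vector_mul_assoc)

text \<open>
  Both sides are the partial Neumann series up to \<open>N\<^bsup>q+1\<^esup> v\<close>: multiplying by \<open>E \<oplus> N\<close> repeats all terms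
  but the last one, and idempotence merges the repetitions.
\<close>

lemma neumann_step:
  "matpow (mat 1 + N) (Suc q) *v v = N *v (matpow (mat 1 + N) q *v v) + v"
proof (induction q)
  case 0
  show ?case
    by (simp add: matrix_vector_mult_add_rdistrib add.commute)
next
  case (Suc q)
  let ?y = "\<lambda>q. matpow (mat 1 + N) q *v v"
  have rec: "?y (Suc j) = ?y j + N *v ?y j" for j
    by (simp only: matpow_Suc_vec matrix_vector_mult_add_rdistrib matrix_vector_mul_lid)
  have absorb: "N *v ?y q + N *v ?y (Suc q) = N *v ?y (Suc q)"
    by (simp only: rec[of q] matrix_vector_right_distrib vec_add_absorb)
  have "?y (Suc (Suc q)) = ?y (Suc q) + N *v ?y (Suc q)"
    by (rule rec)
  also have "\<dots> = (N *v ?y q + v) + N *v ?y (Suc q)"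
    by (simp only: Suc.IH)
  also have "\<dots> = (N *v ?y q + N *v ?y (Suc q)) + v"
    by (simp only: ac_simps)
  also have "\<dots> = N *v ?y (Suc q) + v"
    by (simp only: absorb)
  finally show ?case .
qed

text \<open>One more factor \<open>E \<oplus> N\<close> adds a single new term, so the series stops growing once \<open>N\<^bsup>q+1\<^esup> = \<E>\<close>.\<close>

lemma neumann_last_term:
  "matpow (mat 1 + N) (Suc q) *v v = matpow (mat 1 + N) q *v v + matpow N (Suc q) *v v"
proof (induction q)
  case 0
  show ?case
    by (simp add: matrix_vector_mult_add_rdistrib)
next
  case (Suc q)
  have "matpow (mat 1 + N) (Suc (Suc q)) *v v
      = N *v (matpow (mat 1 + N) q *v v + matpow N (Suc q) *v v) + v"
    by (simp only: neumann_step[of N "Suc q"] Suc)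
  also have "\<dots> = (N *v (matpow (mat 1 + N) q *v v) + v) + N *v (matpow N (Suc q) *v v)"
    by (simp only: matrix_vector_right_distrib ac_simps)
  also have "\<dots> = matpow (mat 1 + N) (Suc q) *v v + matpow N (Suc (Suc q)) *v v"
    by (simp only: neumann_step[of N q] matpow_Suc_vec[of N "Suc q"])
  finally show ?case .
qed

lemma implicit_iterate:
  assumes "x = N *v x + v"
  shows "x = matpow N (Suc q) *v x + matpow (mat 1 + N) q *v v"
proof (induction q)
  case 0
  show ?case
    using assms by simp
next
  case (Suc q)
  have "x = N *v (matpow N (Suc q) *v x + matpow (mat 1 + N) q *v v) + v"
    using assms Suc by simp
  also have "\<dots> = N *v (matpow N (Suc q) *v x) + (N *v (matpow (mat 1 + N) q *v v) + v)"
    by (simp only: matrix_vector_right_distrib ac_simps)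
  also have "\<dots> = matpow N (Suc (Suc q)) *v x + matpow (mat 1 + N) (Suc q) *v v"
    by (simp only: neumann_step matpow_Suc_vec[of N "Suc q"])
  finally show ?case .
qed

lemma implicit_iff_explicit:
  assumes nil: "matpow N (Suc p) = 0"
  shows "x = N *v x + v \<longleftrightarrow> x = matpow (mat 1 + N) p *v v"
proof
  assume "x = N *v x + v"
  from implicit_iterate[OF this, of p] show "x = matpow (mat 1 + N) p *v v"
    by (simp only: nil matrix_vector_mult_0 add_0)
next
  assume x: "x = matpow (mat 1 + N) p *v v"
  have "x = matpow (mat 1 + N) (Suc p) *v v"
    by (simp only: neumann_last_term nil matrix_vector_mult_0 add_0_right x)
  also have "\<dots> = N *v x + v"
    by (simp only: neumann_step x)
  finally show "x = N *v x + v" .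
qed

section \<open>Nilpotency from acyclicity\<close>

text \<open>Along a walk the transitive closure holds between any two positions, and acyclicity makes it irreflexive.\<close>

lemma distinct_walk_if_acyclic:
  assumes "acyclic R" and "successively (\<lambda>x y. (x, y) \<in> R) xs"
  shows "distinct xs"
proof -
  have "successively (\<lambda>x y. (x, y) \<in> R\<^sup>+) xs"
    using assms(2) by (rule successively_mono) auto
  then have "sorted_wrt (\<lambda>x y. (x, y) \<in> R\<^sup>+) xs"
    by (subst (asm) successively_conv_sorted_wrt) (auto simp: transp_def)
  then have "sorted_wrt (\<noteq>) xs"
    by (rule sorted_wrt_mono_rel[rotated]) (use assms(1) in \<open>auto simp: acyclic_def\<close>)
  then show ?thesis
    by (induction xs) auto
qed

lemma path_length_le_longest:
  fixes R :: "('a::finite \<times> 'a) set"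
  assumes "is_path R xs"
  shows "length xs - 1 \<le> longest_path_length R"
proof -
  have "finite {xs :: 'a list. set xs \<subseteq> UNIV \<and> distinct xs}"
    by (rule finite_subset_distinct) simp
  then have "finite {xs. is_path R xs}"
    by (rule finite_subset[rotated]) (auto simp: is_path_def)
  then have "finite {length xs - 1 |xs. is_path R xs}"
    by simp
  then show ?thesis
    unfolding longest_path_length_def using assms by (intro Max_ge) auto
qed

text \<open>
  The arcs of \<open>R\<close> run from column to row index, as suits the transposed adjacency matrices of the
  state equations; an extra factor on the left thus appends a vertex to the walk.
\<close>

lemma walk_of_matpow_entry:
  assumes "graph_of X \<subseteq> R\<inverse>" and "matpow X q $ i $ j \<noteq> 0"
  shows "\<exists>xs. length xs = Suc q \<and> successively (\<lambda>x y. (x, y) \<in> R) xs \<and> last xs = i"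
  using assms(2)
proof (induction q arbitrary: i)
  case 0
  show ?case
    by (rule exI[of _ "[i]"]) simp
next
  case (Suc q)
  have "(\<Sum>l\<in>UNIV. X $ i $ l * matpow X q $ l $ j) \<noteq> 0"
    using Suc.prems by (simp add: matrix_matrix_mult_def)
  then obtain l where l: "X $ i $ l * matpow X q $ l $ j \<noteq> 0"
    by (rule sum.not_neutral_contains_not_neutral)
  then have "X $ i $ l \<noteq> 0" and "matpow X q $ l $ j \<noteq> 0"
    by auto
  then have "(l, i) \<in> R"
    using assms(1) by (auto simp: graph_of_def)
  from \<open>matpow X q $ l $ j \<noteq> 0\<close> Suc.IH obtain xs where "length xs = Suc q" "successively (\<lambda>x y. (x, y) \<in> R) xs" "last xs = l"
    by blast
  with \<open>(l, i) \<in> R\<close> show ?case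
    by (intro exI[of _ "xs @ [i]"]) (auto simp: successively_append_iff)
qed

lemma matpow_eq_0_of_acyclic:
  fixes X :: "maxplus^'n::finite^'n"
  assumes "acyclic R" and "graph_of X \<subseteq> R\<inverse>" and "longest_path_length R < q"
  shows "matpow X q = 0"
proof (rule ccontr)
  assume "matpow X q \<noteq> 0"
  then obtain i j where "matpow X q $ i $ j \<noteq> 0"
    by (auto simp: vec_eq_iff)
  with walk_of_matpow_entry[OF assms(2)] obtain xs
    where "length xs = Suc q" "successively (\<lambda>x y. (x, y) \<in> R) xs"
    by blast
  moreover from this have "is_path R xs"
    using distinct_walk_if_acyclic[OF assms(1)] by (auto simp: is_path_def)
  ultimately show False
    using path_length_le_longest[of R xs] assms(3) by simp
qed

section \<open>Vector form of the network dynamics\<close>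

lemma T_service_component: "(T_service \<tau> k *v x) $ i = Fin (\<tau> i k) * x $ i"
  by (simp add: T_service_def matrix_vector_mult_def if_distrib[where f = "\<lambda>t. t * y" for y]
      cong: if_cong)

lemma graph_of_T_service_mult: "graph_of (T_service \<tau> k ** X) \<subseteq> graph_of X"
proof -
  have "(T_service \<tau> k ** X) $ i $ j = Fin (\<tau> i k) * X $ i $ j" for i j
    by (simp add: T_service_def matrix_matrix_mult_def if_distrib[where f = "\<lambda>t. t * y" for y]
      cong: if_cong)
  then show ?thesis
    by (auto simp: graph_of_def)
qed

lemma graph_of_transpose: "graph_of (transpose X) = (graph_of X)\<inverse>"
  by (auto simp: graph_of_def transpose_def)

lemma finite_lag_le_M_r:
  fixes r :: "'n::finite \<Rightarrow> enat"
  assumes "r i = enat m"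
  shows "m \<le> M_r r"
proof -
  have "finite {m. \<exists>i. r i = enat m}"
    by (rule finite_subset[of _ "range (\<lambda>i. the_enat (r i))"]) (auto simp: image_iff, metis the_enat.simps)
  then show ?thesis
    unfolding M_r_def using assms by (intro Max_ge) auto
qed

lemma finite_lag_le_M_s:
  fixes s :: "'n::finite \<Rightarrow> enat"
  assumes "s i = enat m"
  shows "Suc m \<le> M_s s"
proof -
  have "finite {m + 1 | m. \<exists>i. s i = enat m}"
    by (rule finite_subset[of _ "range (\<lambda>i. the_enat (s i) + 1)"]) (auto simp: image_iff, metis the_enat.simps)
  then show ?thesis
    unfolding M_s_def using assms by (intro Max_ge) auto
qed

lemma G_mat_transpose_component:
  fixes A :: "('n::finite \<times> 'n) set"
  shows "(transpose (G_mat A r m) *v x) $ i = (\<Sum>j\<in>preds A i. if r i = enat m then x $ j else 0)"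
proof -
  have "G_mat A r m $ j $ i = (if j \<in> preds A i \<and> r i = enat m then 1 else 0)" for j
    using finite_lag_le_M_r[of r i m] by (auto simp: G_mat_def)
  then have "(transpose (G_mat A r m) *v x) $ i
      = (\<Sum>j\<in>UNIV. if j \<in> preds A i then if r i = enat m then x $ j else 0 else 0)"
    unfolding matrix_vector_mult_def transpose_def
    by (auto intro!: sum.cong)
  then show ?thesis
    by (simp add: sum.If_cases)
qed

lemma H_mat_component:
  fixes A :: "('n::finite \<times> 'n) set"
  shows "(H_mat A s m *v x) $ i = (\<Sum>j\<in>succs A i. if s j + 1 = enat m then x $ j else 0)"
proof -
  have "(H_mat A s m *v x) $ i
      = (\<Sum>j\<in>UNIV. if j \<in> succs A i then if s j + 1 = enat m then x $ j else 0 else 0)"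
    unfolding matrix_vector_mult_def H_mat_def by (auto intro!: sum.cong)
  then show ?thesis
    by (simp add: sum.If_cases)
qed

lemma delayed_eq_sum:
  assumes "finite S" and "\<And>m. l = enat m \<Longrightarrow> m \<in> S"
  shows "delayed d k l $ j = (\<Sum>m\<in>S. if l = enat m then d (k - int m) $ j else 0)"
  using assms by (cases l) (auto simp: delayed_def)

lemma arrival_eq_sum:
  fixes A :: "('n::finite \<times> 'n) set"
  assumes "M_r r \<le> M"
  shows "arrival A r d k i = (transpose (G_mat A r 0) *v d k) $ i
    + (\<Sum>m = 1..M. (transpose (G_mat A r m) *v d (k - int m)) $ i)"
proof -
  have "delayed d k (r i) $ j = (\<Sum>m = 0..M. if r i = enat m then d (k - int m) $ j else 0)" for j
    using finite_lag_le_M_r[of r i] assms by (intro delayed_eq_sum) (auto intro: order_trans)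
  then have "arrival A r d k i
      = (\<Sum>j\<in>preds A i. \<Sum>m = 0..M. if r i = enat m then d (k - int m) $ j else 0)"
    by (simp add: arrival_def)
  also have "\<dots> = (\<Sum>m = 0..M. (transpose (G_mat A r m) *v d (k - int m)) $ i)"
    by (subst sum.swap) (simp only: G_mat_transpose_component)
  finally show ?thesis
    by (simp add: sum.atLeast_Suc_atMost[of 0 M] del: transpose_matrix_vector)
qed

lemma blocking_eq_sum:
  fixes A :: "('n::finite \<times> 'n) set"
  shows "blocking A s d k i = (\<Sum>m = 1..M_s s. (H_mat A s m *v d (k - int m)) $ i)"
proof -
  have "m \<in> {1..M_s s}" if "s j + 1 = enat m" for j m
    using that finite_lag_le_M_s[of s j] by (cases "s j") (auto simp: one_enat_def)
  then have "delayed d k (s j + 1) $ j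
      = (\<Sum>m = 1..M_s s. if s j + 1 = enat m then d (k - int m) $ j else 0)" for j
    by (intro delayed_eq_sum) auto
  then have "blocking A s d k i
      = (\<Sum>j\<in>succs A i. \<Sum>m = 1..M_s s. if s j + 1 = enat m then d (k - int m) $ j else 0)"
    by (simp add: blocking_def)
  also have "\<dots> = (\<Sum>m = 1..M_s s. (H_mat A s m *v d (k - int m)) $ i)"
    by (subst sum.swap) (simp only: H_mat_component)
  finally show ?thesis .
qed

lemma manufacturing_dynamics_iff:
  "(\<exists>a b c. manufacturing_dynamics A r s \<tau> a b c d) \<longleftrightarrow>
    (\<forall>k\<ge>1. \<forall>i. d k $ i = Fin (\<tau> i k) * (arrival A r d k i + d (k - 1) $ i) + blocking A s d k i)"
  (is "_ \<longleftrightarrow> ?R")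
proof
  assume ?R
  then have "manufacturing_dynamics A r s \<tau> (\<lambda>k. \<chi> i. arrival A r d k i)
      (\<lambda>k. \<chi> i. arrival A r d k i + d (k - 1) $ i)
      (\<lambda>k. \<chi> i. Fin (\<tau> i k) * (arrival A r d k i + d (k - 1) $ i)) d"
    by (simp add: manufacturing_dynamics_def)
  then show "\<exists>a b c. manufacturing_dynamics A r s \<tau> a b c d"
    by blast
qed (auto simp: manufacturing_dynamics_def)

lemma communication_dynamics_iff:
  "(\<exists>a b c. communication_dynamics A r s \<tau> a b c d) \<longleftrightarrow>
    (\<forall>k\<ge>1. \<forall>i. d k $ i = Fin (\<tau> i k) * (arrival A r d k i + d (k - 1) $ i + blocking A s d k i))"
  (is "_ \<longleftrightarrow> ?R")
proof
  assume ?R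
  then have "communication_dynamics A r s \<tau> (\<lambda>k. \<chi> i. arrival A r d k i)
      (\<lambda>k. \<chi> i. arrival A r d k i + d (k - 1) $ i + blocking A s d k i)
      (\<lambda>k. \<chi> i. Fin (\<tau> i k) * (arrival A r d k i + d (k - 1) $ i + blocking A s d k i)) d"
    by (simp add: communication_dynamics_def)
  then show "\<exists>a b c. communication_dynamics A r s \<tau> a b c d"
    by blast
qed (auto simp: communication_dynamics_def)

lemma manufacturing_equation_iff:
  fixes A :: "('n::finite \<times> 'n) set"
  assumes "M_r r \<le> M_s s"
  shows "manufacturing_equation A r s \<tau> (M_s s) d k \<longleftrightarrow>
    (\<forall>i. d k $ i = Fin (\<tau> i k) * (arrival A r d k i + d (k - 1) $ i) + blocking A s d k i)"
  unfolding manufacturing_equation_def vec_eq_iff arrival_eq_sum[OF assms] blocking_eq_sum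
  unfolding matrix_vector_mult_add_rdistrib matrix_vector_mul_assoc[symmetric]
    vector_add_component sum_component T_service_component
    sum.distrib sum_distrib_left[symmetric] distrib_left
  by (simp only: ac_simps)

lemma communication_equation_iff:
  fixes A :: "('n::finite \<times> 'n) set"
  assumes "M_r r \<le> M_s s"
  shows "communication_equation A r s \<tau> (M_s s) d k \<longleftrightarrow>
    (\<forall>i. d k $ i = Fin (\<tau> i k) * (arrival A r d k i + d (k - 1) $ i + blocking A s d k i))"
  unfolding communication_equation_def vec_eq_iff arrival_eq_sum[OF assms] blocking_eq_sum
  unfolding matrix_vector_mult_add_rdistrib matrix_vector_mul_assoc[symmetric]
    vector_add_component sum_component T_service_component
    sum.distrib sum_distrib_left[symmetric] distrib_left
  by (simp only: ac_simps)

section \<open>The explicit state equations\<close>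

lemma matrix_vector_mult_sum_right: "(X::'a::semiring_1^'m^'n) *v (\<Sum>i\<in>S. f i) = (\<Sum>i\<in>S. X *v f i)"
  by (induction S rule: infinite_finite_induct) (simp_all add: matrix_vector_right_distrib)

text \<open>The term with \<open>d(k-1)\<close> that stands alone in the implicit equations is merged into the one for \<open>m = 1\<close>.\<close>

lemma sum_merge_first:
  fixes f :: "nat \<Rightarrow> 'a::comm_monoid_add"
  assumes "1 \<le> M"
  shows "a + (\<Sum>m = 1..M. f m) = (\<Sum>m = 1..M. if m = 1 then a + f 1 else f m)"
proof -
  have "(\<Sum>m = Suc 1..M. if m = 1 then a + f 1 else f m) = (\<Sum>m = Suc 1..M. f m)"
    by (rule sum.cong) auto
  then show ?thesis
    using assms by (simp add: sum.atLeast_Suc_atMost[of 1 M] add.assoc del: One_nat_def)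
qed

lemma manufacturing_equation_iff_explicit:
  fixes A :: "('n::finite \<times> 'n) set"
  assumes nil: "matpow (T_service \<tau> k ** transpose (G_mat A r 0)) (Suc p) = 0" and "1 \<le> M"
  shows "manufacturing_equation A r s \<tau> M d k \<longleftrightarrow>
    d k = (\<Sum>m = 1..M. manufacturing_transition A r s \<tau> p m k *v d (k - int m))"
proof -
  let ?N = "T_service \<tau> k ** transpose (G_mat A r 0)"
  let ?W = "\<lambda>m. T_service \<tau> k ** transpose (G_mat A r m) + H_mat A s m"
  let ?v = "T_service \<tau> k *v d (k - 1) + (\<Sum>m = 1..M. ?W m *v d (k - int m))"
  have "manufacturing_equation A r s \<tau> M d k \<longleftrightarrow> d k = ?N *v d k + ?v"
    by (simp only: manufacturing_equation_def add.assoc)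
  also have "\<dots> \<longleftrightarrow> d k = matpow (mat 1 + ?N) p *v ?v"
    using nil by (rule implicit_iff_explicit)
  also have "?v = (\<Sum>m = 1..M. (if m = 1 then T_service \<tau> k + ?W 1 else ?W m) *v d (k - int m))"
    unfolding sum_merge_first[OF \<open>1 \<le> M\<close>]
    by (rule sum.cong) (auto simp: matrix_vector_mult_add_rdistrib)
  also have "matpow (mat 1 + ?N) p *v \<dots>
      = (\<Sum>m = 1..M. manufacturing_transition A r s \<tau> p m k *v d (k - int m))"
    unfolding matrix_vector_mult_sum_right matrix_vector_mul_assoc
    by (intro sum.cong) (simp_all add: manufacturing_transition_def matrix_mul_assoc add.assoc)
  finally show ?thesis .
qed

lemma communication_equation_iff_explicit:
  fixes A :: "('n::finite \<times> 'n) set"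
  assumes nil: "matpow (T_service \<tau> k ** transpose (G_mat A r 0)) (Suc p) = 0" and "1 \<le> M"
  shows "communication_equation A r s \<tau> M d k \<longleftrightarrow>
    d k = (\<Sum>m = 1..M. communication_transition A r s \<tau> p m k *v d (k - int m))"
proof -
  let ?N = "T_service \<tau> k ** transpose (G_mat A r 0)"
  let ?W = "\<lambda>m. transpose (G_mat A r m) + H_mat A s m"
  let ?v = "d (k - 1) + (\<Sum>m = 1..M. ?W m *v d (k - int m))"
  have "communication_equation A r s \<tau> M d k \<longleftrightarrow> d k = ?N *v d k + T_service \<tau> k *v ?v"
    by (simp only: communication_equation_def add.assoc matrix_vector_right_distrib)
  also have "\<dots> \<longleftrightarrow> d k = matpow (mat 1 + ?N) p *v (T_service \<tau> k *v ?v)"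
    using nil by (rule implicit_iff_explicit)
  also have "?v = (\<Sum>m = 1..M. (if m = 1 then mat 1 + ?W 1 else ?W m) *v d (k - int m))"
    unfolding sum_merge_first[OF \<open>1 \<le> M\<close>]
    by (rule sum.cong) (auto simp: matrix_vector_mult_add_rdistrib)
  also have "matpow (mat 1 + ?N) p *v (T_service \<tau> k *v \<dots>)
      = (\<Sum>m = 1..M. communication_transition A r s \<tau> p m k *v d (k - int m))"
    unfolding matrix_vector_mult_sum_right matrix_vector_mul_assoc
    by (intro sum.cong) (simp_all add: communication_transition_def matrix_mul_assoc add.assoc)
  finally show ?thesis .
qed

theorem mainTheorem2:
  fixes A :: "('n::finite \<times> 'n) set"
    and r s :: "'n \<Rightarrow> enat"
    and \<tau> :: "'n \<Rightarrow> int \<Rightarrow> real"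
    and d :: "int \<Rightarrow> maxplus^'n"
    and M p :: nat
  assumes network: "fork_join_network A r s \<tau>"
    and finite_buffers: "\<exists>i. s i \<noteq> \<infinity>"
    and Mr_le_Ms: "M_r r \<le> M_s s"
    and M: "M = M_s s"
    and acyclic: "acyclic (graph_of (G_mat A r 0))"
    and p: "p = longest_path_length (graph_of (G_mat A r 0))"
    and initial: "initial_departures d"
  shows
    "((\<exists>a b c. manufacturing_dynamics A r s \<tau> a b c d) \<longleftrightarrow>
        (\<forall>k\<ge>1. manufacturing_equation A r s \<tau> M d k)) \<and>
     (\<forall>k\<ge>1. manufacturing_equation A r s \<tau> M d k \<longleftrightarrow>
        d k = (\<Sum>m = 1..M. manufacturing_transition A r s \<tau> p m k *v d (k - int m))) \<and>
     ((\<exists>a b c. communication_dynamics A r s \<tau> a b c d) \<longleftrightarrow>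
        (\<forall>k\<ge>1. communication_equation A r s \<tau> M d k)) \<and>
     (\<forall>k\<ge>1. communication_equation A r s \<tau> M d k \<longleftrightarrow>
        d k = (\<Sum>m = 1..M. communication_transition A r s \<tau> p m k *v d (k - int m)))"
proof -
  have nil: "matpow (T_service \<tau> k ** transpose (G_mat A r 0)) (Suc p) = 0" for k
    using acyclic
  proof (rule matpow_eq_0_of_acyclic)
    show "graph_of (T_service \<tau> k ** transpose (G_mat A r 0)) \<subseteq> (graph_of (G_mat A r 0))\<inverse>"
      using graph_of_T_service_mult by (simp flip: graph_of_transpose)
  qed (simp add: p)
  obtain i m where "s i = enat m"
    using finite_buffers by auto
  then have "1 \<le> M"
    using finite_lag_le_M_s[of s i m] M by simp
  show ?thesis
  proof (intro conjI allI impI)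
    fix k :: int
    show "manufacturing_equation A r s \<tau> M d k \<longleftrightarrow>
        d k = (\<Sum>m = 1..M. manufacturing_transition A r s \<tau> p m k *v d (k - int m))"
      using nil \<open>1 \<le> M\<close> by (rule manufacturing_equation_iff_explicit)
    show "communication_equation A r s \<tau> M d k \<longleftrightarrow>
        d k = (\<Sum>m = 1..M. communication_transition A r s \<tau> p m k *v d (k - int m))"
      using nil \<open>1 \<le> M\<close> by (rule communication_equation_iff_explicit)
  qed (simp_all only: M manufacturing_dynamics_iff communication_dynamics_iff
      manufacturing_equation_iff[OF Mr_le_Ms] communication_equation_iff[OF Mr_le_Ms])
qed

end
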